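(* For every integer $k \geqslant 3$ and every sufficiently large $n$, $$f(n,n,U(k)) \;\leqslant\; \exp\Big( n^{2-1/(k-1)} (\log n)^{k+1} \Big),$$ where $f(n,n,U(k))$ is the number of $U(k)$-free bipartite graphs with (fixed, labelled) vertex classes $A$ and $B$ with $|A| = |B| = n$.
   Context: For $k \in \mathbb{N}$, $U(k)$ is the bipartite graph with parts $A_0$, identified with the set of all subsets of $[k]$ (so $|A_0| = 2^k$), and $B_0 = [k]$, in which $a \in A_0$ is adjacent to $b \in B_0$ iff $b \in a$. A graph $G$ is $U(k)$-free if there do not exist disjoint sets $A', B' \subset V(G)$ such that the bipartite graph $G[A',B']$ (the edges of $G$ between $A'$ and $B'$) is isomorphic to $U(k)$ with $A'$ corresponding to $A_0$ and $B'$ to $B_0$. $f(n,n,U(k)) = |\{G \text{ bipartite on } A \cup B : |A| = |B| = n,\ G \text{ is } U(k)\text{-free}\}|$. *)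

theory Defs
  imports Complex_Main
begin

text \<open>A simple graph is a pair of a vertex set and a set of two-element edges.\<close>

type_synonym 'v graph = "'v set \<times> 'v set set"

abbreviation verts :: "'v graph \<Rightarrow> 'v set" where
  "verts G \<equiv> fst G"

abbreviation edges :: "'v graph \<Rightarrow> 'v set set" where
  "edges G \<equiv> snd G"

text \<open>The vertex classes are fixed: two bipartite graphs on the same pair of classes are
  counted as different as soon as their edge sets differ.\<close>

definition bipartite_on :: "'v set \<Rightarrow> 'v set \<Rightarrow> 'v graph \<Rightarrow> bool" where
  "bipartite_on A B G \<longleftrightarrow>
     A \<inter> B = {} \<and> verts G = A \<union> B \<and> (\<forall>e \<in> edges G. \<exists>a\<in>A. \<exists>b\<in>B. e = {a, b})"

definition between :: "'v graph \<Rightarrow> 'v set \<Rightarrow> 'v set \<Rightarrow> 'v graph" where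
  "between G X Y = (X \<union> Y, {e \<in> edges G. \<exists>x\<in>X. \<exists>y\<in>Y. e = {x, y}})"

definition U_left :: "nat \<Rightarrow> (nat set + nat) set" where
  "U_left k = Inl ` Pow {1..k}"

definition U_right :: "nat \<Rightarrow> (nat set + nat) set" where
  "U_right k = Inr ` {1..k}"

definition U_graph :: "nat \<Rightarrow> (nat set + nat) graph" where
  "U_graph k = (U_left k \<union> U_right k,
     {{Inl a, Inr b} | a b. a \<in> Pow {1..k} \<and> b \<in> {1..k} \<and> b \<in> a})"

definition graph_iso :: "('u \<Rightarrow> 'v) \<Rightarrow> 'u graph \<Rightarrow> 'v graph \<Rightarrow> bool" where
  "graph_iso h H G \<longleftrightarrow>
     bij_betw h (verts H) (verts G) \<and>
     (\<forall>u \<in> verts H. \<forall>v \<in> verts H. {u, v} \<in> edges H \<longleftrightarrow> {h u, h v} \<in> edges G)"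

text \<open>The sets \<open>X\<close> and \<open>Y\<close> below are arbitrary disjoint sets of vertices. For a bipartite \<open>G\<close>
  they need not be contained in different vertex classes: both orientations of \<open>U_graph k\<close> are
  forbidden, and the image of the isolated vertex \<open>Inl {}\<close> may lie in either class.\<close>

definition U_free :: "nat \<Rightarrow> 'v graph \<Rightarrow> bool" where
  "U_free k G \<longleftrightarrow>
     \<not> (\<exists>X Y h. X \<subseteq> verts G \<and> Y \<subseteq> verts G \<and> X \<inter> Y = {} \<and>
          graph_iso h (U_graph k) (between G X Y) \<and>
          h ` U_left k = X \<and> h ` U_right k = Y)"

definition class_A :: "nat \<Rightarrow> (nat + nat) set" where
  "class_A n = Inl ` {1..n}"

definition class_B :: "nat \<Rightarrow> (nat + nat) set" where
  "class_B n = Inr ` {1..n}"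

definition U_free_graphs :: "nat \<Rightarrow> nat \<Rightarrow> nat \<Rightarrow> (nat + nat) graph set" where
  "U_free_graphs m n k = {G. bipartite_on (class_A m) (class_B n) G \<and> U_free k G}"

text \<open>The cardinality below is genuine, not the default value for infinite sets.\<close>

lemma finite_U_free_graphs: "finite (U_free_graphs m n k)"
proof (rule finite_subset)
  let ?V = "class_A m \<union> class_B n"
  show "U_free_graphs m n k \<subseteq> {?V} \<times> Pow (Pow ?V)"
    unfolding U_free_graphs_def bipartite_on_def by force
  show "finite ({?V} \<times> Pow (Pow ?V))"
    by (simp add: class_A_def class_B_def)
qed

definition num_U_free :: "nat \<Rightarrow> nat \<Rightarrow> nat \<Rightarrow> nat" where
  "num_U_free m n k = card (U_free_graphs m n k)"

end

theory Submission
  imports Defs "HOL-Library.FuncSet"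
begin

text \<open>Read a bipartite graph as a family of rows, the neighbourhoods of the vertices of \<open>A\<close> in
  \<open>B\<close>. In a \<open>U(k)\<close>-free graph these shatter no \<open>k\<close>-set; put \<open>d = k - 1\<close>. By Sauer--Shelah,
  \<open>N > (m + 1)^d\<close> rows cannot all be told apart by \<open>m\<close> columns, whereas a well-chosen set of \<open>m\<close>
  columns separates all pairs of rows at distance above \<open>(2 n ln N) / m\<close>. Hence among any \<open>N\<close> rows two
  are at distance \<open>O(n ln n / N powr (1 / d))\<close>. Deleting rows one at a time, each close to a remaining
  one, shows that the graph is determined by data of total size
  \<open>O((\<Sum>N\<le>n. n ln n / N powr (1 / d)) ln n) = O(n powr (2 - 1 / d) (ln n)\<^sup>2)\<close>.\<close>

section \<open>Shattered sets and the Sauer-Shelah bound\<close>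

definition shatters :: "'a set set \<Rightarrow> 'a set \<Rightarrow> bool" where
  "shatters F S \<longleftrightarrow> (\<forall>T\<subseteq>S. \<exists>C\<in>F. C \<inter> S = T)"

lemma shatters_subset:
  assumes "shatters F S" "T \<subseteq> S"
  shows "shatters F T"
  unfolding shatters_def
proof (intro allI impI)
  fix U assume "U \<subseteq> T"
  then obtain C where "C \<in> F" "C \<inter> S = U"
    using assms unfolding shatters_def by (meson subset_trans)
  then show "\<exists>C\<in>F. C \<inter> T = U" using \<open>U \<subseteq> T\<close> \<open>T \<subseteq> S\<close> by blast
qed

text \<open>Pajor's strengthening of Sauer-Shelah, which makes the induction on \<open>S\<close>
  work without binomial sums. Split \<open>F\<close> at the new point \<open>x\<close> into the
  members avoiding \<open>x\<close> (\<open>F0\<close>) and the members containing \<open>x\<close>,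
  with \<open>x\<close> removed (\<open>F1\<close>). A set shattered by either part is shattered by
  \<open>F\<close>; a set \<open>T\<close> shattered by both also makes \<open>insert x T\<close>
  shattered by \<open>F\<close>.\<close>

lemma card_le_card_shattered:
  assumes "finite S" "F \<subseteq> Pow S"
  shows "card F \<le> card {T \<in> Pow S. shatters F T}"
  using assms
proof (induction S arbitrary: F rule: finite_induct)
  case empty
  then have "F = {} \<or> F = {{}}" by auto
  moreover have "{T :: 'a set. T = {} \<and> shatters {{}} T} = {{}}" by (auto simp: shatters_def)
  ultimately show ?case by (elim disjE) simp_all
next
  case (insert x S)
  define F0 where "F0 = {C \<in> F. x \<notin> C}"
  define F1 where "F1 = {C. x \<notin> C \<and> insert x C \<in> F}"
  define sh where "sh E = {T \<in> Pow S. shatters E T}" for E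
  have sub: "F0 \<subseteq> Pow S" "F1 \<subseteq> Pow S"
    using insert.prems insert.hyps by (auto simp: F0_def F1_def)
  have fin: "finite F0" "finite F1" "finite (sh F0)" "finite (sh F1)"
    using sub insert.hyps by (simp_all add: sh_def finite_subset[where B = "Pow S"])
  have inj: "inj_on (insert x) F1" "inj_on (insert x) (sh F0 \<inter> sh F1)"
    using insert.hyps by (auto simp: inj_on_def F1_def sh_def)
  have F: "F = F0 \<union> insert x ` F1"
  proof (intro equalityI subsetI)
    fix C assume C: "C \<in> F"
    show "C \<in> F0 \<union> insert x ` F1"
    proof (cases "x \<in> C")
      case True
      then have "C = insert x (C - {x})" "C - {x} \<in> F1" using C by (auto simp: F1_def insert_absorb)
      then show ?thesis by blast
    qed (use C in \<open>auto simp: F0_def\<close>)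
  qed (auto simp: F0_def F1_def)
  have "card F = card F0 + card (insert x ` F1)"
    by (subst F, rule card_Un_disjoint) (use fin in \<open>auto simp: F0_def\<close>)
  also have "\<dots> = card F0 + card F1" using inj by (simp add: card_image)
  also have "\<dots> \<le> card (sh F0) + card (sh F1)"
    unfolding sh_def using insert.IH sub by (meson add_mono)
  \<comment> \<open>Sets shattered by both parts are counted twice in the sum. Their second copy is
    moved to \<open>insert x T\<close>, which cannot collide with the sets avoiding
    \<open>x\<close>.\<close>
  also have "\<dots> = card (sh F0 \<union> sh F1) + card (insert x ` (sh F0 \<inter> sh F1))"
    using fin inj by (simp only: card_image card_Un_Int[of "sh F0" "sh F1"])
  also have "\<dots> = card ((sh F0 \<union> sh F1) \<union> insert x ` (sh F0 \<inter> sh F1))"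
    by (rule card_Un_disjoint[symmetric]) (use fin insert.hyps in \<open>auto simp: sh_def\<close>)
  also have "\<dots> \<le> card {T \<in> Pow (insert x S). shatters F T}"
  proof (rule card_mono)
    show "finite {T \<in> Pow (insert x S). shatters F T}" using insert.hyps by simp
    have 0: "shatters F T" if "T \<in> sh F0" for T
      using that unfolding shatters_def sh_def F0_def by blast
    have 1: "shatters F T" if T: "T \<in> sh F1" for T
      unfolding shatters_def
    proof (intro allI impI)
      fix U assume "U \<subseteq> T"
      then obtain C where "C \<in> F1" "C \<inter> T = U" using T unfolding sh_def shatters_def by blast
      moreover have "x \<notin> T" using that insert.hyps by (auto simp: sh_def)
      ultimately show "\<exists>C\<in>F. C \<inter> T = U" unfolding F1_def by (intro bexI[of _ "insert x C"]) auto
    qed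
    have 2: "shatters F (insert x T)" if T: "T \<in> sh F0" "T \<in> sh F1" for T
      unfolding shatters_def
    proof (intro allI impI)
      fix U assume U: "U \<subseteq> insert x T"
      have xT: "x \<notin> T" using that insert.hyps by (auto simp: sh_def)
      have U': "U - {x} \<subseteq> T" using U by blast
      show "\<exists>C\<in>F. C \<inter> insert x T = U"
      proof (cases "x \<in> U")
        case True
        obtain C where "C \<in> F1" "C \<inter> T = U - {x}"
          using T(2) U' unfolding sh_def shatters_def by blast
        then show ?thesis using True xT unfolding F1_def by (intro bexI[of _ "insert x C"]) auto
      next
        case False
        obtain C where "C \<in> F0" "C \<inter> T = U - {x}"
          using T(1) U' unfolding sh_def shatters_def by blast
        then show ?thesis using False xT unfolding F0_def by (intro bexI[of _ C]) auto
      qed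
    qed
    show "(sh F0 \<union> sh F1) \<union> insert x ` (sh F0 \<inter> sh F1) \<subseteq> {T \<in> Pow (insert x S). shatters F T}"
      using 0 1 2 by (auto simp: sh_def)
  qed
  finally show ?case .
qed

text \<open>Each nonempty set of size at most \<open>Suc d\<close> arises by inserting a point of
  \<open>S\<close> into one of size at most \<open>d\<close>, so each step costs a factor
  \<open>card S + 1\<close>. The bound serves twice: it makes Sauer-Shelah polynomial, and it later
  counts the possible differences between two close rows.\<close>

lemma card_subsets_le:
  assumes "finite S"
  shows "card {T \<in> Pow S. card T \<le> d} \<le> (card S + 1) ^ d"
proof (induction d)
  case 0
  have "{T \<in> Pow S. card T \<le> 0} = {{}}" using assms by (auto dest: finite_subset)
  then show ?case by (simp del: Pow_iff)
next
  case (Suc d)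
  let ?P = "{T \<in> Pow S. card T \<le> d}"
  have fin: "finite ?P" using assms by simp
  have "{T \<in> Pow S. card T \<le> Suc d} \<subseteq> ?P \<union> (\<lambda>(x, T). insert x T) ` (S \<times> ?P)"
  proof
    fix T assume T: "T \<in> {T \<in> Pow S. card T \<le> Suc d}"
    show "T \<in> ?P \<union> (\<lambda>(x, T). insert x T) ` (S \<times> ?P)"
    proof (cases "T = {}")
      case False
      then obtain x where x: "x \<in> T" by blast
      have "T = insert x (T - {x})" "card (T - {x}) \<le> d"
        using x T by (auto simp: insert_absorb card_Diff_singleton_if)
      then have "(x, T - {x}) \<in> S \<times> ?P" using x T by auto
      then show ?thesis using \<open>T = insert x (T - {x})\<close> by (metis (no_types, lifting) UnI2 case_prod_conv imageI)
    qed auto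
  qed
  then have "card {T \<in> Pow S. card T \<le> Suc d} \<le> card (?P \<union> (\<lambda>(x, T). insert x T) ` (S \<times> ?P))"
    using fin assms by (intro card_mono) auto
  also have "\<dots> \<le> card ?P + card (S \<times> ?P)"
    using fin assms by (meson add_left_mono card_Un_le card_image_le finite_SigmaI le_trans)
  also have "\<dots> = (card S + 1) * card ?P" by (simp add: card_cartesian_product)
  also have "\<dots> \<le> (card S + 1) * (card S + 1) ^ d" using Suc.IH by (rule mult_le_mono2)
  finally show ?case by simp
qed

text \<open>Shattering passes to subsets, so a shattered set with more than \<open>d\<close> points
  would contain a shattered one of size exactly \<open>Suc d\<close>. Hence every subset of
  \<open>S\<close> shattered by the traces has size at most \<open>d\<close>, and such sets are
  few.\<close>

lemma sauer_shelah:
  assumes "finite S" and unsh: "\<And>Y. Y \<subseteq> S \<Longrightarrow> card Y = Suc d \<Longrightarrow> \<not> shatters F Y"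
  shows "card ((\<lambda>C. C \<inter> S) ` F) \<le> (card S + 1) ^ d"
proof -
  let ?F = "(\<lambda>C. C \<inter> S) ` F"
  have "card ?F \<le> card {T \<in> Pow S. shatters ?F T}"
    by (rule card_le_card_shattered) (use assms in auto)
  also have "\<dots> \<le> card {T \<in> Pow S. card T \<le> d}"
  proof (rule card_mono)
    show "finite {T \<in> Pow S. card T \<le> d}" using assms by simp
    show "{T \<in> Pow S. shatters ?F T} \<subseteq> {T \<in> Pow S. card T \<le> d}"
    proof (intro subsetI CollectI conjI)
      fix T assume T: "T \<in> {T \<in> Pow S. shatters ?F T}"
      then show "T \<in> Pow S" by simp
      have eq: "C \<inter> S \<inter> T = C \<inter> T" for C using T by auto
      have sh: "shatters F T" using T unfolding shatters_def by (auto simp: eq)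
      show "card T \<le> d"
      proof (rule ccontr)
        assume "\<not> card T \<le> d"
        then obtain Y where "Y \<subseteq> T" "card Y = Suc d"
          by (metis not_less_eq_eq obtain_subset_with_card_n)
        then show False using unsh[of Y] shatters_subset[OF sh] T by auto
      qed
    qed
  qed
  also have "\<dots> \<le> (card S + 1) ^ d" by (rule card_subsets_le) fact
  finally show ?thesis .
qed

section \<open>Close pairs of rows\<close>

text \<open>Greedy choice: by averaging, some point of \<open>B\<close> lies in a proportion of at least
  \<open>\<delta> / card B\<close> of the sets that have not been hit yet.\<close>

lemma greedy_hitting:
  fixes D :: "'p \<Rightarrow> 'b set"
  assumes "finite B" "finite P" and D: "\<And>p. p \<in> P \<Longrightarrow> D p \<subseteq> B \<and> \<delta> \<le> card (D p)"
  shows "\<exists>S\<subseteq>B. card S \<le> m \<and>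
           card B ^ m * card {p \<in> P. D p \<inter> S = {}} \<le> card P * (card B - \<delta>) ^ m"
proof (induction m)
  case 0
  show ?case by (rule exI[of _ "{}"]) simp
next
  case (Suc m)
  then obtain S where S: "S \<subseteq> B" "card S \<le> m"
    and le: "card B ^ m * card {p \<in> P. D p \<inter> S = {}} \<le> card P * (card B - \<delta>) ^ m" by blast
  define Q where "Q = {p \<in> P. D p \<inter> S = {}}"
  have finQ: "finite Q" using assms by (simp add: Q_def)
  show ?case
  proof (cases "B = {}")
    case True
    \<comment> \<open>For empty \<open>B\<close> the factor \<open>card B ^ Suc m\<close> is 0, so
      the inequality is trivial.\<close>
    then show ?thesis by (intro exI[of _ "{}"]) simp
  next
    case False
    \<comment> \<open>Double counting of the pairs \<open>(b, p)\<close> with \<open>p\<close> not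
      yet hit and \<open>b\<close> outside \<open>D p\<close>.\<close>
    have "(\<Sum>b\<in>B. card {p \<in> Q. b \<notin> D p}) = (\<Sum>p\<in>Q. card {b \<in> B. b \<notin> D p})"
      using assms finQ by (intro sum_multicount_gen) auto
    also have "\<dots> \<le> (\<Sum>p\<in>Q. card B - \<delta>)"
    proof (rule sum_mono)
      fix p assume "p \<in> Q"
      then have p: "D p \<subseteq> B" "\<delta> \<le> card (D p)" using D by (auto simp: Q_def)
      have "{b \<in> B. b \<notin> D p} = B - D p" by blast
      then have "card {b \<in> B. b \<notin> D p} = card B - card (D p)"
        using p assms by (simp add: card_Diff_subset finite_subset)
      then show "card {b \<in> B. b \<notin> D p} \<le> card B - \<delta>" using p by simp
    qed
    finally have sum: "(\<Sum>b\<in>B. card {p \<in> Q. b \<notin> D p}) \<le> card Q * (card B - \<delta>)" by simp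
    \<comment> \<open>The minimum over \<open>b\<close> is at most the average. Multiplying by
      \<open>card B\<close> keeps the inequality within the naturals.\<close>
    obtain b where b: "b \<in> B" "card B * card {p \<in> Q. b \<notin> D p} \<le> card Q * (card B - \<delta>)"
    proof (rule ccontr)
      assume "\<not> thesis"
      then have gt: "\<And>b. b \<in> B \<Longrightarrow> card Q * (card B - \<delta>) < card B * card {p \<in> Q. b \<notin> D p}"
        using that by (meson not_le)
      have "(\<Sum>b\<in>B. card Q * (card B - \<delta>)) < (\<Sum>b\<in>B. card B * card {p \<in> Q. b \<notin> D p})"
        using gt False assms by (intro sum_strict_mono) auto
      then have "card B * (card Q * (card B - \<delta>)) < card B * (\<Sum>b\<in>B. card {p \<in> Q. b \<notin> D p})"
        by (simp add: sum_distrib_left)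
      then show False using sum by simp
    qed
    have eq: "{p \<in> P. D p \<inter> insert b S = {}} = {p \<in> Q. b \<notin> D p}" by (auto simp: Q_def)
    have "card B ^ Suc m * card {p \<in> Q. b \<notin> D p} = card B ^ m * (card B * card {p \<in> Q. b \<notin> D p})"
      by simp
    also have "\<dots> \<le> card B ^ m * (card Q * (card B - \<delta>))" using b(2) by (rule mult_le_mono2)
    also have "\<dots> = (card B ^ m * card Q) * (card B - \<delta>)" by simp
    also have "\<dots> \<le> (card P * (card B - \<delta>) ^ m) * (card B - \<delta>)"
      using le unfolding Q_def by (rule mult_le_mono1)
    finally have "card B ^ Suc m * card {p \<in> Q. b \<notin> D p} \<le> card P * (card B - \<delta>) ^ Suc m"
      by (simp add: ac_simps)
    moreover have "card (insert b S) \<le> Suc m"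
      using S card_insert_le_m1[of "Suc m" S b] by simp
    ultimately show ?thesis using S b(1) eq by (intro exI[of _ "insert b S"]) auto
  qed
qed

text \<open>Rows are indexed rather than collected in a family because different vertices may have
  equal neighbourhoods. Extensionality keeps the set finite for finite \<open>A\<close> and
  \<open>B\<close>, and makes \<open>restrict\<close> the deletion of rows.\<close>

definition unshattering :: "'a set \<Rightarrow> 'b set \<Rightarrow> nat \<Rightarrow> ('a \<Rightarrow> 'b set) set" where
  "unshattering A B k = {f \<in> A \<rightarrow>\<^sub>E Pow B. \<forall>Y\<subseteq>B. card Y = k \<longrightarrow> \<not> shatters (f ` A) Y}"

text \<open>Let \<delta> be the least distance between two rows. Greedily chosen \<open>m\<close>
  columns miss at most a proportion \<open>(1 - \<delta> / card B) ^ m\<close> of the pairs, yet by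
  Sauer-Shelah they cannot separate all pairs. So at least one of at most
  \<open>(card A)\<^sup>2\<close> pairs is missed, which forces
  \<open>exp (\<delta> * m / card B) \<le> (card A)\<^sup>2\<close>.\<close>

lemma close_pair:
  assumes f: "f \<in> unshattering A B (Suc d)" and fin: "finite A" "finite B" and B: "B \<noteq> {}"
    and m: "(m + 1) ^ d < card A"
  shows "\<exists>a\<in>A. \<exists>a'\<in>A. a \<noteq> a' \<and>
           real (card (sym_diff (f a) (f a'))) * real m \<le> 2 * real (card B) * ln (real (card A))"
proof -
  define P where "P = {(a, a'). a \<in> A \<and> a' \<in> A \<and> a \<noteq> a'}"
  define D where "D = (\<lambda>(a, a'). sym_diff (f a) (f a'))"
  have PA: "P \<subseteq> A \<times> A" by (auto simp: P_def)
  then have finP: "finite P" using fin by (meson finite_SigmaI finite_subset)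
  have fB: "f a \<subseteq> B" if "a \<in> A" for a using f that by (auto simp: unshattering_def)
  \<comment> \<open>\<open>(m + 1) ^ d\<close> is at least 1, so \<open>m\<close> already gives two
    distinct rows.\<close>
  have "\<not> card A \<le> Suc 0" using m one_le_power[of "m + 1" d] by linarith
  then have "\<exists>a\<in>A. \<exists>a'\<in>A. a \<noteq> a'"
    using card_le_Suc0_iff_eq[OF fin(1)] by blast
  then have ne: "P \<noteq> {}" by (auto simp: P_def)
  \<comment> \<open>A closest pair: with \<delta> taken as its distance, every pair satisfies the
    lower bound that the greedy choice asks for.\<close>
  define q where "q = arg_min_on (card \<circ> D) P"
  have q: "q \<in> P" "\<And>p. p \<in> P \<Longrightarrow> card (D q) \<le> card (D p)"
    using arg_min_if_finite[OF finP ne, of "card \<circ> D"] unfolding q_def by (auto simp: not_less)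
  define \<delta> where "\<delta> = card (D q)"
  have DB: "D p \<subseteq> B" if "p \<in> P" for p using that fB by (auto simp: D_def P_def)
  have \<delta>B: "\<delta> \<le> card B" unfolding \<delta>_def using DB q(1) fin by (simp add: card_mono)
  obtain S where S: "S \<subseteq> B" "card S \<le> m"
    and le: "card B ^ m * card {p \<in> P. D p \<inter> S = {}} \<le> card P * (card B - \<delta>) ^ m"
    using greedy_hitting[OF fin(2) finP, of D \<delta> m] DB q(2) unfolding \<delta>_def by blast
  have "card ((\<lambda>C. C \<inter> S) ` f ` A) \<le> (card S + 1) ^ d"
    by (rule sauer_shelah) (use S fin f in \<open>auto simp: unshattering_def finite_subset\<close>)
  also have "\<dots> \<le> (m + 1) ^ d" using S by (simp add: power_mono)
  also have "\<dots> < card A" by (rule m)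
  finally have "card ((\<lambda>a. f a \<inter> S) ` A) < card A" by (simp add: image_image)
  then have "\<not> inj_on (\<lambda>a. f a \<inter> S) A" by (rule pigeonhole)
  \<comment> \<open>This unseparated pair only shows that the count of missed pairs is positive; the
    pair finally returned is \<open>q\<close>.\<close>
  then obtain a a' where "a \<in> A" "a' \<in> A" "a \<noteq> a'" "f a \<inter> S = f a' \<inter> S" by (auto simp: inj_on_def)
  then have "(a, a') \<in> {p \<in> P. D p \<inter> S = {}}" by (auto simp: P_def D_def)
  then have "1 \<le> card {p \<in> P. D p \<inter> S = {}}"
    using finP card_gt_0_iff[of "{p \<in> P. D p \<inter> S = {}}"] by force
  then have "card B ^ m \<le> card P * (card B - \<delta>) ^ m"
    using le order_trans[OF mult_le_mono2[of 1 _ "card B ^ m"]] by simp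
  also have "\<dots> \<le> (card A)\<^sup>2 * (card B - \<delta>) ^ m"
    using card_mono[OF _ PA] fin by (intro mult_le_mono1) (simp add: card_cartesian_product power2_eq_square)
  finally have "real (card B ^ m) \<le> real ((card A)\<^sup>2 * (card B - \<delta>) ^ m)" by (rule of_nat_mono)
  then have main: "real (card B) ^ m \<le> real (card A) ^ 2 * (real (card B) - real \<delta>) ^ m"
    using \<delta>B by (simp add: of_nat_diff)
  have Bpos: "real (card B) > 0" using B fin by (simp add: card_gt_0_iff)
  have Apos: "real (card A) > 0" using m by simp
  have "real (card B) - real \<delta> = real (card B) * (1 + (- real \<delta> / real (card B)))"
    using Bpos by (simp add: field_simps)
  also have "\<dots> \<le> real (card B) * exp (- real \<delta> / real (card B))"
    by (intro mult_left_mono exp_ge_add_one_self) simp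
  finally have "(real (card B) - real \<delta>) ^ m \<le> (real (card B) * exp (- real \<delta> / real (card B))) ^ m"
    using \<delta>B by (intro power_mono) auto
  also have "\<dots> = real (card B) ^ m * exp (- (real \<delta> * real m / real (card B)))"
    by (simp add: power_mult_distrib exp_of_nat_mult[symmetric] mult.commute)
  finally have "real (card B) ^ m \<le>
      real (card A) ^ 2 * (real (card B) ^ m * exp (- (real \<delta> * real m / real (card B))))"
    using main by (meson mult_left_mono order_trans zero_le_power2)
  then have "real (card B) ^ m * 1 \<le>
      real (card B) ^ m * (real (card A) ^ 2 * exp (- (real \<delta> * real m / real (card B))))"
    by (simp add: ac_simps)
  then have "1 \<le> real (card A) ^ 2 * exp (- (real \<delta> * real m / real (card B)))"
    using Bpos by (subst (asm) mult_le_cancel_left_pos) auto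
  then have "exp (real \<delta> * real m / real (card B)) \<le> real (card A) ^ 2"
    by (simp add: exp_minus field_simps)
  then have "real \<delta> * real m / real (card B) \<le> ln (real (card A) ^ 2)"
    using Apos by (simp add: ln_ge_iff)
  also have "\<dots> = 2 * ln (real (card A))" using Apos by (simp add: ln_realpow)
  finally have "real \<delta> * real m \<le> 2 * real (card B) * ln (real (card A))"
    using Bpos by (simp add: field_simps)
  then show ?thesis using q(1) unfolding \<delta>_def D_def P_def by auto
qed

text \<open>Optimises the number of columns: \<open>m\<close> is taken just below
  \<open>card A powr (1 / d)\<close>, the threshold where Sauer-Shelah stops forcing two rows to
  agree.\<close>

lemma close_pair_powr:
  assumes f: "f \<in> unshattering A B (Suc d)" and fin: "finite A" "finite B"
    and d: "d \<ge> 1" and A: "card A \<ge> 2" "card A \<le> card B" and B: "card B \<ge> 3"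
  shows "\<exists>a\<in>A. \<exists>a'\<in>A. a \<noteq> a' \<and>
           real (card (sym_diff (f a) (f a')))
             \<le> 4 * real (card B) * ln (real (card B)) / real (card A) powr (1 / real d)"
proof -
  define x where "x = real (card A) powr (1 / real d)"
  have x1: "x > 1" unfolding x_def using A d by (intro gr_one_powr) auto
  have xd: "x ^ d = real (card A)"
    unfolding x_def using d A by (simp add: powr_realpow[symmetric] powr_powr)
  \<comment> \<open>Subtracting 2 makes \<open>m + 1\<close> equal to the ceiling of
    \<open>x\<close> minus 1, hence strictly below \<open>x\<close>, as the strict hypothesis of
    \<open>close_pair\<close> demands. Since \<open>x > 1\<close>, the natural subtraction does not
    truncate.\<close>
  define m where "m = nat \<lceil>x\<rceil> - 2"
  have c2: "\<lceil>x\<rceil> \<ge> 2" using x1 by linarith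
  then have mm: "real m = real_of_int \<lceil>x\<rceil> - 2" unfolding m_def by (simp add: of_nat_diff nat_le_iff le_nat_iff)
  have "real (m + 1) < x" using mm by simp linarith
  then have "real (m + 1) ^ d < x ^ d" using d by (intro power_strict_mono) auto
  then have "real ((m + 1) ^ d) < real (card A)" using xd by simp
  then have "(m + 1) ^ d < card A" by (simp only: of_nat_less_iff)
  then obtain a a' where aa: "a \<in> A" "a' \<in> A" "a \<noteq> a'"
    and le: "real (card (sym_diff (f a) (f a'))) * real m \<le> 2 * real (card B) * ln (real (card A))"
    using close_pair[OF f fin] B by (metis card.empty not_numeral_le_zero)
  let ?\<delta> = "real (card (sym_diff (f a) (f a')))"
  have "exp 1 \<le> (3::real)" by (rule exp_le)
  also have "\<dots> \<le> real (card B)" using B by simp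
  finally have lnB: "1 \<le> ln (real (card B))" using B by (subst ln_ge_iff) auto
  \<comment> \<open>From \<open>x \<ge> 4\<close> on, \<open>m \<ge> x - 2 \<ge> x / 2\<close>,
    which doubles the constant 2. For smaller \<open>x\<close>, where \<open>m\<close> may be 0, the
    trivial bound \<open>card B\<close> on the distance is enough, since
    \<open>ln (card B) \<ge> 1\<close>.\<close>
  have "?\<delta> * x \<le> 4 * real (card B) * ln (real (card B))"
  proof (cases "x \<ge> 4")
    case True
    then have "x / 2 \<le> real m" using mm by linarith
    then have "?\<delta> * (x / 2) \<le> ?\<delta> * real m" by (intro mult_left_mono) auto
    also note le
    also have "2 * real (card B) * ln (real (card A)) \<le> 2 * real (card B) * ln (real (card B))"
      using A by (intro mult_left_mono) auto
    finally show ?thesis by simp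
  next
    case False
    have "sym_diff (f a) (f a') \<subseteq> B" using f aa by (auto simp: unshattering_def)
    then have "?\<delta> \<le> real (card B)" using fin by (simp add: card_mono)
    then have "?\<delta> * x \<le> real (card B) * 4" using False x1 by (intro mult_mono) auto
    also have "\<dots> \<le> real (card B) * 4 * ln (real (card B))"
      using mult_left_mono[OF lnB, of "real (card B) * 4"] by simp
    finally show ?thesis by (simp add: ac_simps)
  qed
  then show ?thesis using aa x1 unfolding x_def[symmetric] by (auto simp: field_simps intro!: bexI)
qed

section \<open>Counting by deleting rows\<close>

lemma restrict_unshattering:
  assumes "f \<in> unshattering A B k" "A' \<subseteq> A"
  shows "restrict f A' \<in> unshattering A' B k"
proof -
  have "shatters (f ` A) Y" if "shatters (f ` A') Y" for Y
    using that assms(2) unfolding shatters_def by (meson image_mono subsetD)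
  then show ?thesis using assms unfolding unshattering_def
    by (auto simp: PiE_iff)
qed

lemma finite_unshattering:
  assumes "finite A" "finite B"
  shows "finite (unshattering A B k)"
proof -
  have "finite (A \<rightarrow>\<^sub>E Pow B)" using assms by (intro finite_PiE) auto
  then show ?thesis by (rule finite_subset[rotated]) (auto simp: unshattering_def)
qed

text \<open>Two rows at distance at most \<open>\<delta> N\<close> exist, so deleting one of them loses only the names of
  the two rows and a set of at most \<open>\<delta> N\<close> columns.\<close>

lemma card_unshattering_le_prod:
  fixes A :: "'a set" and B :: "'b set" and \<delta> :: "nat \<Rightarrow> nat"
  assumes "finite A" "finite B" "A \<noteq> {}" "card A \<le> M"
    and close: "\<And>A' f. \<lbrakk>finite (A' :: 'a set); card A' \<ge> 2; card A' \<le> M; f \<in> unshattering A' B k\<rbrakk> \<Longrightarrow>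
      \<exists>a\<in>A'. \<exists>a'\<in>A'. a \<noteq> a' \<and> card (sym_diff (f a) (f a')) \<le> \<delta> (card A')"
  shows "card (unshattering A B k)
           \<le> 2 ^ card B * (\<Prod>N=2..card A. N\<^sup>2 * (card B + 1) ^ \<delta> N)"
  using assms(1,3,4)
proof (induction "card A" arbitrary: A)
  case 0
  then show ?case by simp
next
  case (Suc N A)
  show ?case
  \<comment> \<open>The recursion stops at a single row, which may be any subset of
    \<open>B\<close>; the product over \<open>{2..1}\<close> is empty.\<close>
  proof (cases "N = 0")
    case True
    have "card (unshattering A B k) \<le> card (A \<rightarrow>\<^sub>E Pow B)"
      using Suc.prems assms(2) by (intro card_mono finite_PiE) (auto simp: unshattering_def)
    also have "\<dots> = 2 ^ card B"
      using Suc.prems Suc.hyps(2) True assms(2) by (simp add: card_PiE card_Pow flip: Suc.hyps(2))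
    finally show ?thesis using True Suc.hyps(2)[symmetric] by simp
  next
    case False
    let ?E = "{E \<in> Pow B. card E \<le> \<delta> (card A)}"
    let ?K = "2 ^ card B * (\<Prod>N=2..N. N\<^sup>2 * (card B + 1) ^ \<delta> N)"
    \<comment> \<open>The decoder: row \<open>a\<close> is recovered from row \<open>a'\<close> of
      the smaller family and the difference \<open>E\<close> of the two rows.\<close>
    define ext where "ext = (\<lambda>(a, a') (g :: 'a \<Rightarrow> 'b set, E). g(a := sym_diff (g a') E))"
    let ?W = "\<lambda>p. unshattering (A - {fst p}) B k \<times> ?E"
    have finW: "finite (?W p)" for p :: "'a \<times> 'a"
      using Suc.prems assms(2) by (intro finite_SigmaI finite_unshattering) auto
    \<comment> \<open>An upper bound only needs a cover, so \<open>p\<close> ranges over all of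
      \<open>A \<times> A\<close>, the diagonal included; this is the factor
      \<open>(card A)\<^sup>2\<close>.\<close>
    have "unshattering A B k \<subseteq> (\<Union>p\<in>A \<times> A. ext p ` ?W p)"
    proof
      fix f assume f: "f \<in> unshattering A B k"
      obtain a a' where a: "a \<in> A" "a' \<in> A" "a \<noteq> a'"
        and E: "card (sym_diff (f a) (f a')) \<le> \<delta> (card A)"
        using close[OF _ _ _ f] Suc.prems Suc.hyps(2) False by auto
      let ?g = "restrict f (A - {a})"
      have ext: "x \<notin> A \<Longrightarrow> f x = undefined" for x
        using f by (auto simp: unshattering_def PiE_iff extensional_def)
      have "f = ext (a, a') (?g, sym_diff (f a) (f a'))"
        using a ext by (auto simp: ext_def fun_eq_iff)
      moreover have "(?g, sym_diff (f a) (f a')) \<in> ?W (a, a')"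
        using restrict_unshattering[OF f] f a E by (auto simp: unshattering_def)
      ultimately show "f \<in> (\<Union>p\<in>A \<times> A. ext p ` ?W p)" using a by blast
    qed
    then have "card (unshattering A B k) \<le> card (\<Union>p\<in>A \<times> A. ext p ` ?W p)"
      using finW Suc.prems by (intro card_mono finite_UN_I) auto
    also have "\<dots> \<le> (\<Sum>p\<in>A \<times> A. card (ext p ` ?W p))"
      using Suc.prems by (intro card_UN_le) auto
    also have "\<dots> \<le> (\<Sum>p\<in>A \<times> A. ?K * (card B + 1) ^ \<delta> (card A))"
    proof (rule sum_mono)
      fix p assume p: "p \<in> A \<times> A"
      then have c: "card (A - {fst p}) = N" using Suc.hyps(2) Suc.prems by auto
      have "card (ext p ` ?W p) \<le> card (?W p)" using finW by (rule card_image_le)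
      also have "\<dots> = card (unshattering (A - {fst p}) B k) * card ?E"
        by (rule card_cartesian_product)
      also have "\<dots> \<le> ?K * (card B + 1) ^ \<delta> (card A)"
      proof (rule mult_le_mono)
        have "A - {fst p} \<noteq> {}" using c False by (metis card.empty)
        then show "card (unshattering (A - {fst p}) B k) \<le> ?K"
          using Suc.hyps(1)[of "A - {fst p}"] c Suc.prems Suc.hyps(2) by simp
        show "card ?E \<le> (card B + 1) ^ \<delta> (card A)" using assms(2) by (rule card_subsets_le)
      qed
      finally show "card (ext p ` ?W p) \<le> ?K * (card B + 1) ^ \<delta> (card A)" .
    qed
    also have "\<dots> = ?K * ((card A)\<^sup>2 * (card B + 1) ^ \<delta> (card A))"
      by (simp add: card_cartesian_product power2_eq_square)
    also have "\<dots> = 2 ^ card B * (\<Prod>N=2..card A. N\<^sup>2 * (card B + 1) ^ \<delta> N)"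
    proof -
      have "{2..card A} = insert (card A) {2..N}" using Suc.hyps(2) False by auto
      then show ?thesis using Suc.hyps(2) by (simp add: mult.assoc mult.commute)
    qed
    finally show ?thesis .
  qed
qed

section \<open>Summing the cost of all deletions\<close>

lemma sum_inverse_sqrt_le:
  "(\<Sum>N=1..n. 1 / sqrt (real N)) \<le> 2 * sqrt (real n)"
proof (induction n)
  case (Suc n)
  define s t where "s = sqrt (real n)" and "t = sqrt (real (Suc n))"
  have st: "s \<ge> 0" "t > 0" "s\<^sup>2 = real n" "t\<^sup>2 = real n + 1" by (auto simp: s_def t_def)
  \<comment> \<open>With \<open>t\<^sup>2 = s\<^sup>2 + 1\<close> this yields
    \<open>1 / t \<le> 2 * (t - s)\<close>, and the right side telescopes.\<close>
  have "0 \<le> (t - s)\<^sup>2" by simp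
  then have "2 * s * t + 1 \<le> 2 * t\<^sup>2" unfolding power2_diff using st by (simp add: mult.commute mult.left_commute)
  then have "2 * s + 1 / t \<le> 2 * t" using st(2) by (simp add: field_simps power2_eq_square)
  then show ?case using Suc.IH by (simp add: s_def t_def)
qed simp

text \<open>Reduction to the square root case: for \<open>s \<le> 1 / 2\<close> the quotient
  \<open>N powr (1 / 2 - s)\<close> of the two summands is largest at \<open>N = n\<close>. This
  gives the constant 2 uniformly in \<open>s\<close>; the application has \<open>s = 1 / d\<close>
  with \<open>d \<ge> 2\<close>.\<close>

lemma sum_inverse_powr_le:
  assumes "0 \<le> s" "s \<le> 1 / 2" "n \<ge> 1"
  shows "(\<Sum>N=1..n. 1 / real N powr s) \<le> 2 * real n powr (1 - s)"
proof -
  have "(\<Sum>N=1..n. 1 / real N powr s) \<le> (\<Sum>N=1..n. real n powr (1 / 2 - s) * (1 / sqrt (real N)))"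
  proof (rule sum_mono)
    fix N assume N: "N \<in> {1..n}"
    have "1 / real N powr s = real N powr (1 / 2 - s) * (1 / sqrt (real N))"
      using N by (simp add: powr_diff powr_half_sqrt)
    also have "\<dots> \<le> real n powr (1 / 2 - s) * (1 / sqrt (real N))"
      using N assms by (intro mult_right_mono powr_mono2) auto
    finally show "1 / real N powr s \<le> real n powr (1 / 2 - s) * (1 / sqrt (real N))" .
  qed
  also have "\<dots> \<le> real n powr (1 / 2 - s) * (2 * sqrt (real n))"
    unfolding sum_distrib_left[symmetric] by (intro mult_left_mono sum_inverse_sqrt_le) auto
  also have "\<dots> = 2 * (real n powr (1 / 2 - s) * real n powr (1 / 2))"
    by (simp add: powr_half_sqrt)
  also have "\<dots> = 2 * real n powr (1 - s)" by (simp add: powr_add[symmetric])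
  finally show ?thesis .
qed

text \<open>With \<open>L = ln n\<close> and \<open>X = n powr (2 - 1 / d)\<close>, the exponent
  collects \<open>n * L\<close> for the last remaining row, \<open>2 * n * L\<close> for the names
  of the rows, and \<open>16 * X * L\<^sup>2\<close> for the differences. One logarithm there comes
  from the distance bound, the other from naming a column.\<close>

lemma card_unshattering_le:
  assumes "finite A" "finite B" "card A = n" "card B = n" "n \<ge> 3" "d \<ge> 2"
  shows "real (card (unshattering A B (Suc d)))
           \<le> exp (19 * real n powr (2 - 1 / real d) * (ln (real n))\<^sup>2)"
proof -
  define s where "s = 1 / real d"
  have s: "0 \<le> s" "s \<le> 1 / 2" using \<open>d \<ge> 2\<close> by (auto simp: s_def field_simps)
  define L where "L = ln (real n)"
  define y where "y N = 4 * real n * L / real N powr s" for N :: nat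
  define \<delta> where "\<delta> N = nat \<lfloor>y N\<rfloor>" for N
  have "exp 1 \<le> (3::real)" by (rule exp_le)
  also have "\<dots> \<le> real n" using assms by simp
  finally have L: "1 \<le> L" using assms unfolding L_def by (subst ln_ge_iff) auto
  have y0: "0 \<le> y N" for N using L by (simp add: y_def)
  have "card (unshattering A B (Suc d)) \<le> 2 ^ card B * (\<Prod>N=2..card A. N\<^sup>2 * (card B + 1) ^ \<delta> N)"
  proof (rule card_unshattering_le_prod[where M = n])
    fix A' f assume A': "finite A'" "2 \<le> card A'" "card A' \<le> n" "f \<in> unshattering (A' :: 'a set) B (Suc d)"
    obtain a a' where "a \<in> A'" "a' \<in> A'" "a \<noteq> a'" "real (card (sym_diff (f a) (f a'))) \<le> y (card A')"
      using close_pair_powr[OF A'(4,1) \<open>finite B\<close>] A' assms unfolding y_def L_def s_def by auto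
    then show "\<exists>a\<in>A'. \<exists>a'\<in>A'. a \<noteq> a' \<and> card (sym_diff (f a) (f a')) \<le> \<delta> (card A')"
      unfolding \<delta>_def by (meson le_nat_floor)
  qed (use assms in auto)
  then have "real (card (unshattering A B (Suc d))) \<le>
      real (2 ^ n * (\<Prod>N=2..n. N\<^sup>2 * (n + 1) ^ \<delta> N))"
    using assms by (simp only: of_nat_le_iff)
  also have "\<dots> = 2 ^ n * (\<Prod>N=2..n. (real N)\<^sup>2 * (real n + 1) ^ \<delta> N)"
    by (simp add: add.commute)
  \<comment> \<open>Every base is compared with a power of \<open>n = exp L\<close>:
    \<open>2 \<le> n\<close>, \<open>N \<le> n\<close> and
    \<open>n + 1 \<le> 2 * n \<le> n\<^sup>2\<close>.\<close>
  also have "\<dots> \<le> exp (real n * L) * (\<Prod>N=2..n. exp (2 * L + 2 * L * y N))"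
  proof (intro mult_mono prod_mono conjI)
    have "(2::real) ^ n \<le> (exp L) ^ n" using assms by (intro power_mono) (auto simp: L_def)
    then show "(2::real) ^ n \<le> exp (real n * L)" by (simp add: exp_of_nat_mult)
    fix N assume N: "N \<in> {2..n}"
    have "real n + 1 \<le> 2 * real n" using assms by simp
    also have "\<dots> \<le> real n * real n" using assms by (intro mult_right_mono) auto
    finally have nn: "real n + 1 \<le> (exp L)\<^sup>2" using assms by (simp add: L_def power2_eq_square)
    have "(real n + 1) ^ \<delta> N \<le> ((exp L)\<^sup>2) ^ \<delta> N" using nn by (intro power_mono) auto
    also have "\<dots> = exp (2 * L * real (\<delta> N))" 
      by (simp add: power_mult[symmetric] exp_of_nat_mult[symmetric] mult_ac)
    also have "\<dots> \<le> exp (2 * L * y N)"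
      using L y0[of N] unfolding \<delta>_def by simp
    finally have 1: "(real n + 1) ^ \<delta> N \<le> exp (2 * L * y N)" .
    have "(real N)\<^sup>2 \<le> (exp L)\<^sup>2" using N by (intro power_mono) (auto simp: L_def)
    also have "\<dots> = exp (2 * L)" by (simp add: exp_double)
    finally show "(real N)\<^sup>2 * (real n + 1) ^ \<delta> N \<le> exp (2 * L + 2 * L * y N)"
      unfolding exp_add using 1 by (intro mult_mono) auto
  qed (auto intro!: prod_nonneg)
  also have "\<dots> = exp (real n * L + (\<Sum>N=2..n. 2 * L + 2 * L * y N))"
    by (simp add: exp_add exp_sum)
  also have "\<dots> \<le> exp (19 * real n powr (2 - s) * L\<^sup>2)"
  proof -
    let ?X = "real n powr (2 - s)"
    have "(\<Sum>N=2..n. 2 * L + 2 * L * y N) \<le> (\<Sum>N=1..n. 2 * L + 2 * L * y N)"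
      using L y0 by (intro sum_mono2) auto
    also have "\<dots> = 2 * L * real n + 8 * real n * L\<^sup>2 * (\<Sum>N=1..n. 1 / real N powr s)"
      by (simp add: sum.distrib y_def sum_distrib_left power2_eq_square algebra_simps)
    also have "\<dots> \<le> 2 * L * real n + 8 * real n * L\<^sup>2 * (2 * real n powr (1 - s))"
      using sum_inverse_powr_le[OF s, of n] assms by (intro add_left_mono mult_left_mono) auto
    also have "\<dots> = 2 * L * real n + 16 * ?X * L\<^sup>2"
    proof -
      have "?X = real n * real n powr (1 - s)"
        using assms powr_add[of "real n" 1 "1 - s"] by simp
      then show ?thesis by simp
    qed
    finally have 1: "(\<Sum>N=2..n. 2 * L + 2 * L * y N) \<le> 2 * L * real n + 16 * ?X * L\<^sup>2" .
    \<comment> \<open>Both \<open>n \<le> X\<close> and \<open>L \<le> L\<^sup>2\<close> hold, so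
      the lower-order terms \<open>3 * n * L\<close> are absorbed, raising 16 to 19.\<close>
    have "real n powr 1 \<le> ?X" using s assms by (intro powr_mono) auto
    then have "real n * L \<le> ?X * L\<^sup>2" 
      using L assms by (intro mult_mono) (auto simp: power2_eq_square)
    then show ?thesis using 1 by (simp add: algebra_simps)
  qed
  finally show ?thesis unfolding s_def L_def .
qed

section \<open>From graphs to families of rows\<close>

definition rows :: "nat \<Rightarrow> nat \<Rightarrow> (nat + nat) graph \<Rightarrow> nat \<Rightarrow> nat set" where
  "rows m n G = (\<lambda>a\<in>{1..m}. {b \<in> {1..n}. {Inl a, Inr b} \<in> edges G})"

lemma inj_on_rows: "inj_on (rows m n) {G. bipartite_on (class_A m) (class_B n) G}"
proof (rule inj_onI)
  have sub: "edges G \<subseteq> edges H"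
    if G: "bipartite_on (class_A m) (class_B n) G" and eq: "rows m n G = rows m n H" for G H
  proof
    fix e assume e: "e \<in> edges G"
    then obtain a b where ab: "a \<in> {1..m}" "b \<in> {1..n}" "e = {Inl a, Inr b}"
      using G by (fastforce simp: bipartite_on_def class_A_def class_B_def)
    then have "b \<in> rows m n G a" using e by (simp add: rows_def)
    then have "b \<in> rows m n H a" by (simp add: eq)
    then show "e \<in> edges H" using ab by (simp add: rows_def)
  qed
  fix G H
  assume GH: "G \<in> {G. bipartite_on (class_A m) (class_B n) G}"
    "H \<in> {G. bipartite_on (class_A m) (class_B n) G}" "rows m n G = rows m n H"
  then have "edges G = edges H" using sub[of G H] sub[of H G] by auto
  moreover have "verts G = verts H" using GH by (simp add: bipartite_on_def)
  ultimately show "G = H" by (rule prod_eqI[rotated])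
qed

lemma in_edges_between_iff:
  assumes "x \<in> X" "y \<in> Y"
  shows "{x, y} \<in> edges (between G X Y) \<longleftrightarrow> {x, y} \<in> edges G"
proof -
  have "\<exists>x'\<in>X. \<exists>y'\<in>Y. {x, y} = {x', y'}" by (intro bexI[of _ x] bexI[of _ y] refl assms)
  then show ?thesis by (simp only: between_def snd_conv mem_Collect_eq simp_thms)
qed

text \<open>A shattered \<open>k\<close>-set \<open>Y\<close> is the right side of a copy of
  \<open>U_graph k\<close>: identify \<open>{1..k}\<close> with \<open>Y\<close> by \<sigma>, and
  send each subset \<open>T\<close> to a vertex \<open>\<alpha> T\<close> whose row meets
  \<open>Y\<close> exactly in the image of \<open>T\<close>.\<close>

lemma U_free_imp_not_shatters:
  assumes G: "bipartite_on (class_A m) (class_B n) G" and free: "U_free k G"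
    and Y: "Y \<subseteq> {1..n}" "card Y = k"
  shows "\<not> shatters (rows m n G ` {1..m}) Y"
proof
  assume sh: "shatters (rows m n G ` {1..m}) Y"
  have "finite Y" using Y finite_subset by blast
  then obtain \<sigma> where \<sigma>: "bij_betw \<sigma> {1..k} Y"
    using Y by (metis card_atLeastAtMost diff_Suc_1 finite_atLeastAtMost finite_same_card_bij)
  have "\<exists>a\<in>{1..m}. rows m n G a \<inter> Y = \<sigma> ` T" if "T \<subseteq> {1..k}" for T
  proof -
    have "\<sigma> ` T \<subseteq> Y" using that \<sigma> by (auto simp: bij_betw_def)
    then show ?thesis using sh unfolding shatters_def by auto
  qed
  then obtain \<alpha> where \<alpha>: "\<And>T. T \<subseteq> {1..k} \<Longrightarrow> \<alpha> T \<in> {1..m} \<and> rows m n G (\<alpha> T) \<inter> Y = \<sigma> ` T"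
    by metis
  define h :: "nat set + nat \<Rightarrow> nat + nat" where "h = map_sum \<alpha> \<sigma>"
  let ?X = "h ` U_left k" and ?Y = "h ` U_right k"
  have \<sigma>_in: "\<sigma> b \<in> Y" if "b \<in> {1..k}" for b using \<sigma> that by (auto simp: bij_betw_def)
  have \<sigma>_mem: "\<sigma> b \<in> \<sigma> ` T \<longleftrightarrow> b \<in> T" if "b \<in> {1..k}" "T \<subseteq> {1..k}" for b T
    using \<sigma> that by (intro inj_on_image_mem_iff) (auto simp: bij_betw_def)
  \<comment> \<open>Different subsets prescribe different traces on \<open>Y\<close>, so the chosen
    vertices are automatically distinct.\<close>
  have inj\<alpha>: "inj_on \<alpha> (Pow {1..k})"
  proof (rule inj_onI)
    fix S T assume ST: "S \<in> Pow {1..k}" "T \<in> Pow {1..k}" "\<alpha> S = \<alpha> T"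
    then have "\<sigma> ` S = \<sigma> ` T" using \<alpha>[of S] \<alpha>[of T] by auto
    then show "S = T" using \<sigma> ST by (auto simp: bij_betw_def inj_on_image_eq_iff)
  qed
  have inj: "inj_on h (verts (U_graph k))"
  proof (rule inj_onI)
    fix u v assume "u \<in> verts (U_graph k)" "v \<in> verts (U_graph k)" "h u = h v"
    then show "u = v"
      using inj_onD[OF inj\<alpha>] inj_onD[OF bij_betw_imp_inj_on[OF \<sigma>]]
      by (cases u; cases v; simp add: U_graph_def U_left_def U_right_def h_def image_iff)
  qed
  have adj: "{Inl (\<alpha> T), Inr (\<sigma> b)} \<in> edges G \<longleftrightarrow> b \<in> T" if "b \<in> {1..k}" "T \<subseteq> {1..k}" for b T
  proof -
    have "{Inl (\<alpha> T), Inr (\<sigma> b)} \<in> edges G \<longleftrightarrow> \<sigma> b \<in> rows m n G (\<alpha> T) \<inter> Y"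
      using \<alpha>[OF that(2)] \<sigma>_in[OF that(1)] Y by (auto simp: rows_def)
    then show ?thesis using \<alpha>[OF that(2)] \<sigma>_mem[OF that] by simp
  qed
  have X: "?X \<subseteq> class_A m" using \<alpha> by (auto simp: U_left_def h_def class_A_def)
  have Y': "?Y \<subseteq> class_B n" 
    using \<sigma>_in subsetD[OF Y(1)]
    by (auto simp: U_right_def h_def class_B_def simp del: atLeastAtMost_iff intro!: imageI)
  have "graph_iso h (U_graph k) (between G ?X ?Y)"
    unfolding graph_iso_def
  proof (intro conjI ballI)
    show "bij_betw h (verts (U_graph k)) (verts (between G ?X ?Y))"
      using inj by (simp add: bij_betw_def between_def U_graph_def image_Un)
    have LR: "{Inl T, Inr b} \<in> edges (U_graph k) \<longleftrightarrow> {h (Inl T), h (Inr b)} \<in> edges (between G ?X ?Y)"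
      if "T \<subseteq> {1..k}" "b \<in> {1..k}" for T b
    proof -
      have "{Inl T, Inr b} \<in> edges (U_graph k) \<longleftrightarrow> b \<in> T"
        using that by (auto simp: U_graph_def doubleton_eq_iff)
      moreover have "{h (Inl T), h (Inr b)} \<in> edges (between G ?X ?Y) \<longleftrightarrow>
          {h (Inl T), h (Inr b)} \<in> edges G"
      proof -
        have "h (Inl T) \<in> ?X" "h (Inr b) \<in> ?Y"
          using that by (simp_all add: U_left_def U_right_def)
        then show ?thesis by (rule in_edges_between_iff)
      qed
      ultimately show ?thesis using adj[OF that(2,1)] by (simp add: h_def)
    qed
    \<comment> \<open>\<open>graph_iso\<close> compares all pairs, including \<open>u = v\<close>.
      Inside one side neither graph has an edge, because \<open>h\<close> preserves the tags
      \<open>Inl\<close> and \<open>Inr\<close> and edges of either graph join different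
      tags.\<close>
    have LL: "{Inl S, Inl T} \<notin> edges (U_graph k)" "{h (Inl S), h (Inl T)} \<notin> edges (between G ?X ?Y)"
      and RR: "{Inr b, Inr c} \<notin> edges (U_graph k)" "{h (Inr b), h (Inr c)} \<notin> edges (between G ?X ?Y)"
      for S T b c
      by (auto simp: U_graph_def between_def doubleton_eq_iff h_def U_left_def U_right_def)
    fix u v assume "u \<in> verts (U_graph k)" "v \<in> verts (U_graph k)"
    then have uv: "\<And>S. u = Inl S \<Longrightarrow> S \<subseteq> {1..k}" "\<And>b. u = Inr b \<Longrightarrow> b \<in> {1..k}"
        "\<And>S. v = Inl S \<Longrightarrow> S \<subseteq> {1..k}" "\<And>b. v = Inr b \<Longrightarrow> b \<in> {1..k}"
      by (auto simp: U_graph_def U_left_def U_right_def)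
    show "{u, v} \<in> edges (U_graph k) \<longleftrightarrow> {h u, h v} \<in> edges (between G ?X ?Y)"
    proof (cases u)
      case u: (Inl S)
      show ?thesis
      proof (cases v)
        case (Inl T)
        show ?thesis unfolding u Inl using LL by blast
      next
        case (Inr b)
        show ?thesis unfolding u Inr by (rule LR[OF uv(1)[OF u] uv(4)[OF Inr]])
      qed
    next
      case u: (Inr b)
      show ?thesis
      proof (cases v)
        case (Inl T)
        show ?thesis
          unfolding u Inl insert_commute[of "Inr b"] insert_commute[of "h (Inr b)"]
          by (rule LR[OF uv(3)[OF Inl] uv(2)[OF u]])
      next
        case (Inr c)
        show ?thesis unfolding u Inr using RR by blast
      qed
    qed
  qed
  moreover have "?X \<subseteq> verts G" "?Y \<subseteq> verts G" "?X \<inter> ?Y = {}"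
    using X Y' G unfolding bipartite_on_def by (auto simp del: image_subset_iff)
  ultimately have "\<exists>X Y h. X \<subseteq> verts G \<and> Y \<subseteq> verts G \<and> X \<inter> Y = {} \<and>
      graph_iso h (U_graph k) (between G X Y) \<and> h ` U_left k = X \<and> h ` U_right k = Y"
    by (intro exI[of _ ?X] exI[of _ ?Y] exI[of _ h] conjI refl)
  then show False using free unfolding U_free_def by (rule notE[rotated])
qed

lemma num_U_free_le_card_unshattering:
  "num_U_free m n k \<le> card (unshattering {1..m} {1..n} k)"
  unfolding num_U_free_def
proof (rule card_inj_on_le)
  show "inj_on (rows m n) (U_free_graphs m n k)"
    by (rule inj_on_subset[OF inj_on_rows]) (auto simp: U_free_graphs_def)
  show "rows m n ` U_free_graphs m n k \<subseteq> unshattering {1..m} {1..n} k"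
    using U_free_imp_not_shatters
    by (auto simp: U_free_graphs_def unshattering_def rows_def[abs_def] PiE_iff)
  show "finite (unshattering {1..m} {1..n} k)" by (simp add: finite_unshattering)
qed

theorem theorem3:
  fixes k :: nat
  assumes "k \<ge> 3"
  shows "\<forall>\<^sub>F n in sequentially.
           real (num_U_free n n k)
             \<le> exp (real n powr (2 - 1 / (real k - 1)) * ln (real n) ^ (k + 1))"
proof -
  define d where "d = k - 1"
  have d: "k = Suc d" "d \<ge> 2" "real k - 1 = real d" using assms by (auto simp: d_def)
  \<comment> \<open>For \<open>n \<ge> exp 5\<close> the squared logarithm is at least 25, so it
    absorbs the constant 19. This leaves the fourth power of the logarithm, and
    \<open>4 \<le> k + 1\<close>.\<close>
  have "\<forall>\<^sub>F n in sequentially. n \<ge> nat \<lceil>exp 5 :: real\<rceil>" by (rule eventually_ge_at_top)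
  moreover have "\<forall>\<^sub>F n in sequentially. n \<ge> (3::nat)" by (rule eventually_ge_at_top)
  ultimately show ?thesis
  proof eventually_elim
    case (elim n)
    let ?L = "ln (real n)" and ?X = "real n powr (2 - 1 / real d)"
    have "exp 5 \<le> real n" using elim(1) by (meson nat_ceiling_le_eq)
    then have L: "5 \<le> ?L" using elim(2) by (subst ln_ge_iff) auto
    have "19 * ?L\<^sup>2 \<le> ?L\<^sup>2 * ?L\<^sup>2"
      using L power_mono[of 5 ?L 2] by (intro mult_right_mono) auto
    also have "\<dots> = ?L ^ 4" by (simp add: power_add[symmetric])
    also have "\<dots> \<le> ?L ^ (k + 1)" using L assms by (intro power_increasing) auto
    finally have pow: "19 * ?L\<^sup>2 \<le> ?L ^ (k + 1)" .
    have "real (num_U_free n n k) \<le> real (card (unshattering {1..n} {1..n} k))"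
      using num_U_free_le_card_unshattering by simp
    also have "\<dots> \<le> exp (19 * ?X * ?L\<^sup>2)"
      unfolding d(1) using elim(2) d(2) by (intro card_unshattering_le) auto
    also have "\<dots> = exp (?X * (19 * ?L\<^sup>2))" by (simp add: ac_simps)
    also have "\<dots> \<le> exp (?X * ?L ^ (k + 1))" using pow by (simp add: mult_left_mono)
    finally show ?case unfolding d(3) .
  qed
qed

end
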